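(* Let $k,m,n\in\mathbb{Z}$ and $N=\begin{pmatrix}4k+3&2m+1\\0&4n+3\end{pmatrix}\in UT_2(\mathbb{Z})$. Then there are no four matrices in $UT_2(\mathbb{Z})$ having the Jordan $D(N)$-property. Consequently, there is no upper-triangular Jordan $D(N)$-quadruple.
   Context: $UT_2(\mathbb{Z})$ denotes the ring of upper-triangular $2\times 2$ integer matrices, and $A\circ B=\frac12(AB+BA)$ (computed over $\mathbb{Q}$) is the Jordan product. For $N\in UT_2(\mathbb{Z})$, four matrices $A_1,A_2,A_3,A_4\in UT_2(\mathbb{Z})$ (not necessarily distinct or nonzero) have the Jordan $D(N)$-property if for every $1\le i<j\le 4$ there exists $X_{ij}\in UT_2(\mathbb{Z})$ with $A_i\circ A_j+N=X_{ij}^2$. If moreover the $A_i$ are distinct and nonzero, then $\{A_1,A_2,A_3,A_4\}$ is called an upper-triangular Jordan $D(N)$-quadruple. *)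

theory Defs
  imports "Jordan_Normal_Form.Matrix"
begin

definition UT2 :: "int mat set" where
  "UT2 = {A \<in> carrier_mat 2 2. upper_triangular A}"

abbreviation rat_mat :: "int mat \<Rightarrow> rat mat" where
  "rat_mat \<equiv> map_mat rat_of_int"

definition jordan_prod :: "rat mat \<Rightarrow> rat mat \<Rightarrow> rat mat"  (infixl "\<circ>\<^sub>J" 70) where
  "A \<circ>\<^sub>J B = (1 / 2) \<cdot>\<^sub>m (A * B + B * A)"

text \<open>The four matrices are the values of \<open>A\<close> at \<open>1, 2, 3, 4\<close>; other values of \<open>A\<close> are
  irrelevant. The equation is over the rationals, so its solvability by an integer matrix \<open>X\<close>
  includes the integrality of its left-hand side.\<close>

definition jordan_D_property :: "int mat \<Rightarrow> (nat \<Rightarrow> int mat) \<Rightarrow> bool" where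
  "jordan_D_property N A \<longleftrightarrow>
     (\<forall>i\<in>{1..4}. A i \<in> UT2) \<and>
     (\<forall>i\<in>{1..4}. \<forall>j\<in>{1..4}. i < j \<longrightarrow>
        (\<exists>X\<in>UT2. rat_mat (A i) \<circ>\<^sub>J rat_mat (A j) + rat_mat N = rat_mat (X ^\<^sub>m 2)))"

definition jordan_D_quadruple :: "int mat \<Rightarrow> int mat set \<Rightarrow> bool" where
  "jordan_D_quadruple N S \<longleftrightarrow>
     (\<exists>A. jordan_D_property N A \<and> inj_on A {1..4} \<and>
          (\<forall>i\<in>{1..4}. A i \<noteq> 0\<^sub>m 2 2) \<and> S = A ` {1..4})"

lemma mat_of_rows_list_in_UT2: "mat_of_rows_list 2 [[a, b], [0, d]] \<in> UT2"
  by (auto simp: UT2_def mat_of_rows_list_def upper_triangular_def less_Suc_eq numeral_2_eq_2)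

end

theory Submission
  imports Defs
begin

text \<open>Write \<open>A\<^sub>i\<close> with diagonal \<open>a\<^sub>i, d\<^sub>i\<close>, corner \<open>b\<^sub>i\<close> and trace \<open>s\<^sub>i = a\<^sub>i + d\<^sub>i\<close>. The condition on
  a pair says that \<open>a\<^sub>i a\<^sub>j + 4k + 3 = x\<^sup>2\<close>, \<open>d\<^sub>i d\<^sub>j + 4n + 3 = z\<^sup>2\<close> and
  \<open>s\<^sub>i b\<^sub>j + s\<^sub>j b\<^sub>i + 2 (2m + 1) = 2 y (x + z)\<close>, and it fails for parity reasons.

  As 3 is not a square modulo 4, the \<open>a\<^sub>i\<close> contain at most one even number, and so do the \<open>d\<^sub>i\<close>;
  moreover all odd \<open>a\<^sub>i\<close> are congruent modulo 4, and so are all odd \<open>d\<^sub>i\<close>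
  (\<open>even_root_cong_if_odd_prod\<close>). Call \<open>A\<^sub>i\<close> diagonally odd if \<open>a\<^sub>i\<close> and \<open>d\<^sub>i\<close> are odd. For two
  diagonally odd matrices the corner equation, read modulo 4, forces exactly one of \<open>b\<^sub>i, b\<^sub>j\<close>
  to be even (\<open>jordan_pair_odd_corner_sum\<close>); hence three of them cannot coexist. So
  exactly two are diagonally odd, one of the \<open>a\<close>'s and one of the \<open>d\<close>'s are even, and these occur
  in different matrices, which thus have odd trace. The corner equation between such a matrix and
  a diagonally odd one makes the corner of the latter even (\<open>jordan_pair_even_corner\<close>), so both
  diagonally odd matrices have even corners, a contradiction.\<close>

text \<open>The integer form of the condition on two matrices with diagonals \<open>a, d\<close> and \<open>a', d'\<close> and
  corners \<open>b\<close> and \<open>b'\<close>; the last equation is doubled to clear the denominator of the Jordan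
  product.\<close>

definition jordan_pair ::
    "int \<Rightarrow> int \<Rightarrow> int \<Rightarrow> int \<Rightarrow> int \<Rightarrow> int \<Rightarrow> int \<Rightarrow> int \<Rightarrow> int \<Rightarrow> bool" where
  "jordan_pair k m n a b d a' b' d' \<longleftrightarrow> (\<exists>x y z.
     a * a' + (4 * k + 3) = x\<^sup>2 \<and> d * d' + (4 * n + 3) = z\<^sup>2 \<and>
     (a + d) * b' + (a' + d') * b + 2 * (2 * m + 1) = 2 * (y * (x + z)))"

lemma jordan_pair_commute:
  "jordan_pair k m n a b d a' b' d' \<longleftrightarrow> jordan_pair k m n a' b' d' a b d"
  unfolding jordan_pair_def by (simp add: mult.commute add.commute add.left_commute)

lemma square_mod_4: "(x::int)\<^sup>2 mod 4 = (if even x then 0 else 1)"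
proof (cases "even x")
  case True
  then obtain c where "x = 2 * c" by auto
  then show ?thesis by (simp add: power2_eq_square)
next
  case False
  then obtain c where "x = 2 * c + 1" by (auto elim: oddE)
  then have "x\<^sup>2 = 4 * (c\<^sup>2 + c) + 1" by (simp add: power2_eq_square algebra_simps)
  then show ?thesis using False by presburger
qed

lemma odd_factor_if_prod_plus_3_square:
  fixes a b k x :: int
  assumes "a * b + (4 * k + 3) = x\<^sup>2"
  shows "odd a \<or> odd b"
proof (rule ccontr)
  assume "\<not> (odd a \<or> odd b)"
  then obtain u v where "a = 2 * u" "b = 2 * v" by (auto elim!: evenE)
  then have "x\<^sup>2 = 4 * (u * v + k) + 3" using assms by (simp add: algebra_simps)
  then have "x\<^sup>2 mod 4 = 3" by presburger
  then show False by (simp add: square_mod_4 split: if_splits)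
qed

text \<open>Here \<open>x\<^sup>2\<close> is even, hence divisible by 4, so \<open>a b\<close> is congruent to 1 modulo 4; every odd
  number is its own inverse modulo 4.\<close>

lemma even_root_cong_if_odd_prod:
  fixes a b k x :: int
  assumes "a * b + (4 * k + 3) = x\<^sup>2" and "odd a" and "odd b"
  shows "even x" and "4 dvd a - b"
proof -
  have "even (x\<^sup>2)"
    unfolding assms(1)[symmetric] using assms(2,3) by simp
  then show x: "even x" by simp
  then have "(a * b + (4 * k + 3)) mod 4 = 0"
    using assms(1) square_mod_4[of x] by simp
  moreover obtain u v where uv: "a = 2 * u + 1" "b = 2 * v + 1"
    using assms(2,3) by (auto elim!: oddE)
  then have "a * b = 4 * (u * v) + 2 * (u + v) + 1" by (simp add: algebra_simps)
  ultimately have "even (u + v)" by presburger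
  then show "4 dvd a - b" unfolding uv by presburger
qed

lemma jordan_pair_odd_diagonal:
  assumes "jordan_pair k m n a b d a' b' d'"
  shows "odd a \<or> odd a'" and "odd d \<or> odd d'"
  using assms odd_factor_if_prod_plus_3_square unfolding jordan_pair_def by blast+

text \<open>The half traces \<open>t\<close> and \<open>t'\<close> have the same parity because the traces agree modulo 4, and
  \<open>x + z\<close> is even. So the halved corner equation reads \<open>t (b + b') + 1 = 0\<close> modulo 2.\<close>

lemma jordan_pair_odd_corner_sum:
  assumes "jordan_pair k m n a b d a' b' d'" and "odd a" "odd d" "odd a'" "odd d'"
  shows "odd (b + b')"
proof -
  from assms(1) obtain x y z where
    x: "a * a' + (4 * k + 3) = x\<^sup>2" and z: "d * d' + (4 * n + 3) = z\<^sup>2" and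
    y: "(a + d) * b' + (a' + d') * b + 2 * (2 * m + 1) = 2 * (y * (x + z))"
    unfolding jordan_pair_def by blast
  have "even x" "4 dvd a - a'" "even z" "4 dvd d - d'"
    using even_root_cong_if_odd_prod[OF x] even_root_cong_if_odd_prod[OF z] assms(2-) by blast+
  obtain t t' where t: "a + d = 2 * t" "a' + d' = 2 * t'"
    using assms(2-) by (metis dvdE odd_even_add)
  have "even (t - t')"
    using \<open>4 dvd a - a'\<close> \<open>4 dvd d - d'\<close> t by presburger
  moreover have "t * b' + t' * b + (2 * m + 1) = y * (x + z)"
    using y unfolding t by (simp add: algebra_simps)
  then have "even (t * b' + t' * b + (2 * m + 1))"
    using \<open>even x\<close> \<open>even z\<close> by simp
  ultimately show ?thesis by auto
qed

text \<open>The doubled corner equation read modulo 2: the term with the even trace vanishes, and the odd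
  trace is the coefficient of \<open>b\<close>.\<close>

lemma jordan_pair_even_corner:
  assumes "jordan_pair k m n a b d a' b' d'" and "even (a + d)" and "odd (a' + d')"
  shows "even b"
proof -
  from assms(1) obtain w where "(a + d) * b' + (a' + d') * b + 2 * (2 * m + 1) = 2 * w"
    unfolding jordan_pair_def by blast
  then have "even ((a + d) * b' + (a' + d') * b + 2 * (2 * m + 1))" by simp
  with assms(2,3) show ?thesis by simp
qed

lemma no_four_pairwise_jordan_pairs:
  fixes a b d :: "nat \<Rightarrow> int"
  assumes pairs: "\<And>i j. i \<in> {1..4} \<Longrightarrow> j \<in> {1..4} \<Longrightarrow> i < j \<Longrightarrow>
    jordan_pair k m n (a i) (b i) (d i) (a j) (b j) (d j)"
  shows False
proof -
  define Od where "Od i \<longleftrightarrow> odd (a i) \<and> odd (d i)" for i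
  have P: "jordan_pair k m n (a i) (b i) (d i) (a j) (b j) (d j)"
    if "i \<in> {1..4}" "j \<in> {1..4}" "i \<noteq> j" for i j
    using that pairs jordan_pair_commute by (metis nat_neq_iff)
  have A: "odd (a i) \<or> odd (a j)" "odd (d i) \<or> odd (d j)"
    if "i \<in> {1..4}" "j \<in> {1..4}" "i \<noteq> j" for i j
    using jordan_pair_odd_diagonal[OF P[OF that]] by blast+
  have in4: "1 \<in> {1..4::nat}" "2 \<in> {1..4::nat}" "3 \<in> {1..4::nat}" "4 \<in> {1..4::nat}" by auto
  have ne: "1 \<noteq> (2::nat)" "1 \<noteq> (3::nat)" "1 \<noteq> (4::nat)"
    "2 \<noteq> (3::nat)" "2 \<noteq> (4::nat)" "3 \<noteq> (4::nat)" by auto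
  \<comment> \<open>An even \<open>a\<close> and an even \<open>d\<close> spoil at most two indices, which leaves \<open>p\<close> and \<open>q\<close>; if one index
    has both, three diagonally odd indices remain and \<open>r\<close> is one of them.\<close>
  obtain p q r where pqr: "p \<in> {1..4}" "q \<in> {1..4}" "r \<in> {1..4}" "p \<noteq> q" "p \<noteq> r" "q \<noteq> r"
    and O: "Od p" "Od q" and r: "odd (a r) \<or> odd (d r)"
    using A[OF in4(1,2) ne(1)] A[OF in4(1,3) ne(2)] A[OF in4(1,4) ne(3)]
      A[OF in4(2,3) ne(4)] A[OF in4(2,4) ne(5)] A[OF in4(3,4) ne(6)] in4 ne
    unfolding Od_def by metis
  have odd_sum: "odd (b i + b j)" if "i \<in> {1..4}" "j \<in> {1..4}" "i \<noteq> j" "Od i" "Od j" for i j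
    using jordan_pair_odd_corner_sum[OF P] that unfolding Od_def by blast
  have pq: "odd (b p + b q)" using odd_sum pqr O by blast
  show False
  proof (cases "Od r")
    case True
    then have "odd (b p + b r)" "odd (b q + b r)" using odd_sum pqr O by blast+
    with pq show False by auto
  next
    case False
    with r have tr: "odd (a r + d r)" by (auto simp: Od_def)
    have "even (b i)" if "i \<in> {p, q}" for i
    proof -
      have "even (a i + d i)" using that O by (auto simp: Od_def)
      moreover have "jordan_pair k m n (a i) (b i) (d i) (a r) (b r) (d r)"
        using P that pqr by blast
      ultimately show ?thesis using jordan_pair_even_corner tr by blast
    qed
    with pq show False by auto
  qed
qed

lemma jordan_pair_if_jordan_prod_square:
  assumes "A \<in> UT2" and "B \<in> UT2" and "X \<in> UT2"
    and N: "N = mat_of_rows_list 2 [[4 * k + 3, 2 * m + 1], [0, 4 * n + 3]]"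
    and eq: "rat_mat A \<circ>\<^sub>J rat_mat B + rat_mat N = rat_mat (X ^\<^sub>m 2)"
  shows "jordan_pair k m n (A $$ (0,0)) (A $$ (0,1)) (A $$ (1,1))
    (B $$ (0,0)) (B $$ (0,1)) (B $$ (1,1))"
proof -
  have c: "A \<in> carrier_mat 2 2" "B \<in> carrier_mat 2 2" "X \<in> carrier_mat 2 2"
    and low: "A $$ (1,0) = 0" "B $$ (1,0) = 0" "X $$ (1,0) = 0"
    using assms(1-3) by (auto simp: UT2_def upper_triangular_def)
  have Nc: "N \<in> carrier_mat 2 2" unfolding N by (simp add: mat_of_rows_list_def numeral_2_eq_2)
  have sq: "X ^\<^sub>m 2 = X * X" using c by (simp add: numeral_2_eq_2)
  have entry: "(A $$ (i,0) * B $$ (0,j) + A $$ (i,1) * B $$ (1,j))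
      + (B $$ (i,0) * A $$ (0,j) + B $$ (i,1) * A $$ (1,j)) + 2 * N $$ (i,j)
      = 2 * (X $$ (i,0) * X $$ (0,j) + X $$ (i,1) * X $$ (1,j))"
    if ij: "i < 2" "j < 2" for i j
  proof -
    have "(rat_mat A \<circ>\<^sub>J rat_mat B + rat_mat N) $$ (i,j) = rat_mat (X * X) $$ (i,j)"
      using eq sq by simp
    then have "1 / 2 * (rat_of_int (A $$ (i,0)) * rat_of_int (B $$ (0,j))
          + rat_of_int (A $$ (i,1)) * rat_of_int (B $$ (1,j))
          + (rat_of_int (B $$ (i,0)) * rat_of_int (A $$ (0,j))
          + rat_of_int (B $$ (i,1)) * rat_of_int (A $$ (1,j)))) + rat_of_int (N $$ (i,j))
        = rat_of_int (X $$ (i,0) * X $$ (0,j) + X $$ (i,1) * X $$ (1,j))"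
      using ij c Nc
      by (simp add: jordan_prod_def scalar_prod_def numeral_2_eq_2)
    then have "rat_of_int ((A $$ (i,0) * B $$ (0,j) + A $$ (i,1) * B $$ (1,j))
      + (B $$ (i,0) * A $$ (0,j) + B $$ (i,1) * A $$ (1,j)) + 2 * N $$ (i,j))
      = rat_of_int (2 * (X $$ (i,0) * X $$ (0,j) + X $$ (i,1) * X $$ (1,j)))"
      by (simp add: field_simps)
    then show ?thesis by (simp only: of_int_eq_iff)
  qed
  have Ne: "N $$ (0,0) = 4 * k + 3" "N $$ (0,1) = 2 * m + 1" "N $$ (1,1) = 4 * n + 3"
    unfolding N by (simp_all add: mat_of_rows_list_def)
  show ?thesis
    unfolding jordan_pair_def
  proof (intro exI conjI)
    show "A $$ (0,0) * B $$ (0,0) + (4 * k + 3) = (X $$ (0,0))\<^sup>2"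
      using entry[of 0 0] low Ne by (simp add: power2_eq_square)
    show "A $$ (1,1) * B $$ (1,1) + (4 * n + 3) = (X $$ (1,1))\<^sup>2"
      using entry[of 1 1] low Ne by (simp add: power2_eq_square)
    show "(A $$ (0,0) + A $$ (1,1)) * B $$ (0,1) + (B $$ (0,0) + B $$ (1,1)) * A $$ (0,1)
        + 2 * (2 * m + 1) = 2 * (X $$ (0,1) * (X $$ (0,0) + X $$ (1,1)))"
      using entry[of 0 1] Ne by (simp add: algebra_simps)
  qed
qed

theorem proposition9:
  fixes k m n :: int and N :: "int mat"
  assumes "N = mat_of_rows_list 2 [[4 * k + 3, 2 * m + 1], [0, 4 * n + 3]]"
  shows "(\<nexists>A. jordan_D_property N A) \<and> (\<nexists>S. jordan_D_quadruple N S)"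
proof -
  have "\<not> jordan_D_property N A" for A
  proof
    assume A: "jordan_D_property N A"
    show False
    proof (rule no_four_pairwise_jordan_pairs)
      fix i j :: nat
      assume "i \<in> {1..4}" "j \<in> {1..4}" "i < j"
      with A obtain X where "A i \<in> UT2" "A j \<in> UT2" "X \<in> UT2"
        "rat_mat (A i) \<circ>\<^sub>J rat_mat (A j) + rat_mat N = rat_mat (X ^\<^sub>m 2)"
        unfolding jordan_D_property_def by blast
      then show "jordan_pair k m n (A i $$ (0,0)) (A i $$ (0,1)) (A i $$ (1,1))
          (A j $$ (0,0)) (A j $$ (0,1)) (A j $$ (1,1))"
        using jordan_pair_if_jordan_prod_square assms by blast
    qed
  qed
  then show ?thesis unfolding jordan_D_quadruple_def by blast
qed

end
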